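(* Let $G=(V,E)$ be a finite simple undirected graph with $N=|V|\ge 1$ vertices, describing the interference on every channel. For each integer $C\ge 1$ let $\Theta(C)$ be the asymptotic aggregate throughput of the multi-channel CSMA network on $G$ with $C$ channels. Then: (i) $\Theta(C)=\mathcal A(C)/C$ for every $C\ge 1$; (ii) $\Theta(C)=\alpha(G)$ for every $1\le C\le C^*(G)$, where $C^*(G)$ is the maximum number of pairwise disjoint maximum independent sets of $G$; (iii) $\Theta(C)=N/C$ for every $C\ge\chi(G)$; (iv) $\Theta(C)$ is a non-increasing function of the number of channels $C\in\{1,2,\dots\}$.
   Context: For $V=\{1,\dots,N\}$ and an integer $C\ge1$, the set of feasible states is $$\mathcal X_C=\{x\in\{0,1,\dots,C\}^N:\ \text{for every }(i,j)\in E,\ x_ix_j=0\text{ or }x_i\ne x_j\},$$ where $x_i=0$ means node $i$ is inactive and $x_i=c\ge1$ means node $i$ is active on channel $c$. For $x\in\mathcal X_C$ let $a(x)=\sum_{i=1}^N\mathbf 1_{\{x_i\ne0\}}$ be the number of active nodes, and let $\mathcal A(C)=\max_{x\in\mathcal X_C}a(x)$. Homogeneous rates are assumed: every inactive node activates on each channel at rate $\nu>0$ (when no neighbor is active on that channel) and every active node deactivates at rate $1$. The stationary distribution of the resulting Markov process on $\mathcal X_C$ is $\pi_C(x)=Z^{-1}\nu^{a(x)}$, $x\in\mathcal X_C$, with $Z=\sum_{x\in\mathcal X_C}\nu^{a(x)}$. Each channel has capacity $1/C$, so the throughput of node $i$ is $$\theta_i(C)=\frac1C\sum_{x\in\mathcal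 X_C}\pi_C(x)\mathbf 1_{\{x_i\ne0\}}$$ (which depends on $\nu$), and the aggregate throughput is $\Theta(C)=\lim_{\nu\to\infty}\sum_{i\in V}\theta_i(C)$. $\alpha(G)$ is the independence number of $G$ (size of a largest independent set), a maximum independent set is an independent set of size $\alpha(G)$, and $\chi(G)$ is the chromatic number of $G$. *)

theory Defs
  imports Complex_Main "HOL-Library.FuncSet" "HOL-Library.Disjoint_Sets"
    "Graph_Theory.Pair_Digraph"
begin

text \<open>
  A finite simple undirected graph is a \<^locale>\<open>pair_graph\<close>: a finite, loop-free digraph whose arc set
  is a symmetric set of ordered pairs of vertices. Each undirected edge is thus present in \<open>parcs G\<close>
  in both orientations.
\<close>

section \<open>Graph parameters\<close>

definition independent_set :: "'v pair_pre_digraph \<Rightarrow> 'v set \<Rightarrow> bool" where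
  "independent_set G S \<longleftrightarrow> S \<subseteq> pverts G \<and> (\<forall>u\<in>S. \<forall>v\<in>S. (u, v) \<notin> parcs G)"

definition independence_number :: "'v pair_pre_digraph \<Rightarrow> nat" where
  "independence_number G = Max (card ` {S. independent_set G S})"

definition maximum_independent_set :: "'v pair_pre_digraph \<Rightarrow> 'v set \<Rightarrow> bool" where
  "maximum_independent_set G S \<longleftrightarrow> independent_set G S \<and> card S = independence_number G"

text \<open>
  The number \<open>C\<^sup>*(G)\<close>. Families are sets of sets; nothing is lost, since for a nonempty graph
  maximum independent sets are nonempty, so pairwise disjoint ones are distinct.
\<close>

definition max_disjoint_mis :: "'v pair_pre_digraph \<Rightarrow> nat" where
  "max_disjoint_mis G =
     Max (card ` {F. (\<forall>S\<in>F. maximum_independent_set G S) \<and> disjoint F})"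

definition proper_coloring :: "'v pair_pre_digraph \<Rightarrow> nat \<Rightarrow> ('v \<Rightarrow> nat) \<Rightarrow> bool" where
  "proper_coloring G k f \<longleftrightarrow>
     f \<in> pverts G \<rightarrow> {1..k} \<and> (\<forall>(u, v)\<in>parcs G. f u \<noteq> f v)"

definition chromatic_number :: "'v pair_pre_digraph \<Rightarrow> nat" where
  "chromatic_number G = (LEAST k. \<exists>f. proper_coloring G k f)"

section \<open>Multi-channel CSMA\<close>

text \<open>
  A state assigns \<open>0\<close> (inactive) or an active channel in \<open>{1..C}\<close> to each vertex. States are
  extensional functions (fixed to \<open>undefined\<close> off the vertex set), so that they correspond one-to-one
  to vectors indexed by the vertices.
\<close>

definition feasible_states :: "'v pair_pre_digraph \<Rightarrow> nat \<Rightarrow> ('v \<Rightarrow> nat) set" where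
  "feasible_states G C =
     {x \<in> pverts G \<rightarrow>\<^sub>E {0..C}. \<forall>(i, j)\<in>parcs G. x i * x j = 0 \<or> x i \<noteq> x j}"

definition num_active :: "'v pair_pre_digraph \<Rightarrow> ('v \<Rightarrow> nat) \<Rightarrow> nat" where
  "num_active G x = (\<Sum>i\<in>pverts G. of_bool (x i \<noteq> 0))"

definition max_active :: "'v pair_pre_digraph \<Rightarrow> nat \<Rightarrow> nat" where
  "max_active G C = Max (num_active G ` feasible_states G C)"

definition partition_function :: "'v pair_pre_digraph \<Rightarrow> nat \<Rightarrow> real \<Rightarrow> real" where
  "partition_function G C \<nu> = (\<Sum>x\<in>feasible_states G C. \<nu> ^ num_active G x)"

text \<open>
  The product-form stationary distribution of the activity process with activation rate \<open>\<nu>\<close> per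
  channel and unit deactivation rate.
\<close>

definition stationary_prob ::
  "'v pair_pre_digraph \<Rightarrow> nat \<Rightarrow> real \<Rightarrow> ('v \<Rightarrow> nat) \<Rightarrow> real" where
  "stationary_prob G C \<nu> x = inverse (partition_function G C \<nu>) * \<nu> ^ num_active G x"

text \<open>The factor \<open>1 / C\<close> is the capacity of a single channel.\<close>

definition throughput :: "'v pair_pre_digraph \<Rightarrow> nat \<Rightarrow> real \<Rightarrow> 'v \<Rightarrow> real" where
  "throughput G C \<nu> i =
     1 / real C * (\<Sum>x\<in>feasible_states G C. stationary_prob G C \<nu> x * of_bool (x i \<noteq> 0))"

definition aggregate_throughput :: "'v pair_pre_digraph \<Rightarrow> nat \<Rightarrow> real" where
  "aggregate_throughput G C = Lim at_top (\<lambda>\<nu>. \<Sum>i\<in>pverts G. throughput G C \<nu> i)"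

end

theory Submission
  imports Defs
begin

text \<open>
  As \<open>\<nu> \<rightarrow> \<infinity>\<close> the stationary distribution concentrates on the states with the most active nodes,
  whence \<open>\<Theta>(C) = \<A>(C) / C\<close>. A feasible state is the same thing as a family of \<open>C\<close> pairwise
  disjoint independent sets, one per channel. Each of them has at most \<open>\<alpha>(G)\<close> elements, with
  equality throughout possible iff \<open>C \<le> C\<^sup>*(G)\<close>; and dropping the smallest of \<open>C + 1\<close> classes
  does not decrease the average class size, which gives monotonicity.
\<close>

section \<open>Limits of weighted means of powers\<close>

lemma tendsto_power_quotient:
  fixes k m :: nat
  assumes "k \<le> m"
  shows "((\<lambda>\<nu>::real. \<nu> ^ k / \<nu> ^ m) \<longlongrightarrow> of_bool (k = m)) at_top"
proof (cases "k = m")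
  case True
  have "eventually (\<lambda>\<nu>::real. \<nu> ^ k / \<nu> ^ m = of_bool (k = m)) at_top"
    using eventually_gt_at_top[of 0] by eventually_elim (use True in auto)
  then show ?thesis
    by (rule tendsto_eventually)
next
  case False
  with assms have "0 < m - k" by simp
  then have "((\<lambda>\<nu>::real. inverse (\<nu> ^ (m - k))) \<longlongrightarrow> 0) at_top"
    by (intro tendsto_inverse_0_at_top filterlim_pow_at_top filterlim_ident)
  moreover have "eventually (\<lambda>\<nu>::real. inverse (\<nu> ^ (m - k)) = \<nu> ^ k / \<nu> ^ m) at_top"
    using eventually_gt_at_top[of 0]
    by eventually_elim (use assms in \<open>simp add: power_diff field_simps\<close>)
  ultimately show ?thesis
    using False by (auto intro: Lim_transform_eventually)
qed

text \<open>Dividing numerator and denominator by \<open>\<nu> ^ M\<close>, with \<open>M\<close>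
  the largest exponent, kills every term with \<open>a x < M\<close> in the limit. The denominator
  then tends to the number of maximizers and the numerator to \<open>M\<close> times that
  number.\<close>

lemma tendsto_power_weighted_mean:
  fixes a :: "'a \<Rightarrow> nat"
  assumes fin: "finite X" and ne: "X \<noteq> {}"
  shows "((\<lambda>\<nu>::real. (\<Sum>x\<in>X. real (a x) * \<nu> ^ a x) / (\<Sum>x\<in>X. \<nu> ^ a x))
           \<longlongrightarrow> real (Max (a ` X))) at_top"
proof -
  define M where "M = Max (a ` X)"
  define K where "K = (\<Sum>x\<in>X. of_bool (a x = M) :: real)"
  have le: "a x \<le> M" if "x \<in> X" for x
    using that fin by (simp add: M_def)
  have "M \<in> a ` X"
    unfolding M_def using fin ne by (intro Max_in) auto
  then obtain x0 where "x0 \<in> X" "a x0 = M" by auto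
  \<comment> \<open>The maximizer \<open>x0\<close> keeps the limit of the denominator positive, so
    the two limits may be divided.\<close>
  then have "of_bool (a x0 = M) \<le> K"
    unfolding K_def using fin by (intro member_le_sum) auto
  then have K: "K > 0"
    using \<open>a x0 = M\<close> by simp
  have num: "((\<lambda>\<nu>. \<Sum>x\<in>X. real (a x) * (\<nu> ^ a x / \<nu> ^ M))
      \<longlongrightarrow> (\<Sum>x\<in>X. real (a x) * of_bool (a x = M))) at_top"
    by (intro tendsto_sum tendsto_mult tendsto_const tendsto_power_quotient le)
  have den: "((\<lambda>\<nu>. \<Sum>x\<in>X. \<nu> ^ a x / \<nu> ^ M) \<longlongrightarrow> K) at_top"
    unfolding K_def by (intro tendsto_sum tendsto_power_quotient le)
  have eq: "(\<Sum>x\<in>X. real (a x) * of_bool (a x = M)) = real M * K"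
    unfolding K_def sum_distrib_left by (rule sum.cong) auto
  have "((\<lambda>\<nu>. (\<Sum>x\<in>X. real (a x) * (\<nu> ^ a x / \<nu> ^ M)) / (\<Sum>x\<in>X. \<nu> ^ a x / \<nu> ^ M))
      \<longlongrightarrow> real M * K / K) at_top"
    using tendsto_divide[OF num den] K eq by simp
  moreover have "eventually (\<lambda>\<nu>::real.
      (\<Sum>x\<in>X. real (a x) * (\<nu> ^ a x / \<nu> ^ M)) / (\<Sum>x\<in>X. \<nu> ^ a x / \<nu> ^ M)
      = (\<Sum>x\<in>X. real (a x) * \<nu> ^ a x) / (\<Sum>x\<in>X. \<nu> ^ a x)) at_top"
    using eventually_gt_at_top[of 0]
    by eventually_elim (simp flip: sum_divide_distrib)
  ultimately show ?thesis
    using K unfolding M_def by (auto intro: Lim_transform_eventually)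
qed

text \<open>Exchanging the sums over nodes and states yields the stationary mean of
  \<open>num_active\<close> divided by \<open>C\<close>, the form covered by
  \<open>tendsto_power_weighted_mean\<close>.\<close>

lemma sum_throughput:
  "(\<Sum>i\<in>pverts G. throughput G C \<nu> i) =
     ((\<Sum>x\<in>feasible_states G C. real (num_active G x) * \<nu> ^ num_active G x)
       / (\<Sum>x\<in>feasible_states G C. \<nu> ^ num_active G x)) / real C"
proof -
  have "(\<Sum>i\<in>pverts G. throughput G C \<nu> i) =
      1 / real C * (\<Sum>i\<in>pverts G. \<Sum>x\<in>feasible_states G C.
        stationary_prob G C \<nu> x * of_bool (x i \<noteq> 0))"
    unfolding throughput_def sum_distrib_left ..
  also have "(\<Sum>i\<in>pverts G. \<Sum>x\<in>feasible_states G C. stationary_prob G C \<nu> x * of_bool (x i \<noteq> 0))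
      = (\<Sum>x\<in>feasible_states G C. stationary_prob G C \<nu> x * real (num_active G x))"
    by (subst sum.swap) (simp add: num_active_def sum_distrib_left)
  also have "\<dots> = (\<Sum>x\<in>feasible_states G C. real (num_active G x) * \<nu> ^ num_active G x)
      / (\<Sum>x\<in>feasible_states G C. \<nu> ^ num_active G x)"
    unfolding stationary_prob_def partition_function_def sum_divide_distrib
    by (rule sum.cong) (auto simp: field_simps)
  finally show ?thesis by simp
qed

lemma num_active_eq_card:
  "finite (pverts G) \<Longrightarrow> num_active G x = card {i \<in> pverts G. x i \<noteq> 0}"
  by (simp add: num_active_def of_bool_def sum.If_cases Int_def)

context pair_graph
begin

section \<open>Feasible states and the limiting throughput\<close>

lemma finite_feasible_states: "finite (feasible_states G C)"
  by (rule finite_subset[OF _ finite_PiE[of "pverts G" "\<lambda>_. {0..C}"]])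
     (auto simp: feasible_states_def)

lemma feasible_states_nonempty: "feasible_states G C \<noteq> {}"
proof -
  have "restrict (\<lambda>_. 0) (pverts G) \<in> feasible_states G C"
    by (auto simp: feasible_states_def dest: wellformed')
  then show ?thesis by blast
qed

lemma num_active_le_max_active: "x \<in> feasible_states G C \<Longrightarrow> num_active G x \<le> max_active G C"
  unfolding max_active_def by (intro Max_ge) (auto simp: finite_feasible_states)

lemma max_active_attained:
  obtains x where "x \<in> feasible_states G C" "num_active G x = max_active G C"
proof -
  have "max_active G C \<in> num_active G ` feasible_states G C"
    unfolding max_active_def
    by (intro Max_in) (auto simp: finite_feasible_states feasible_states_nonempty)
  then show thesis using that by auto
qed

lemma max_active_le_card: "max_active G C \<le> card (pverts G)"
proof -
  obtain x where "num_active G x = max_active G C" by (rule max_active_attained)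
  then show ?thesis
    using card_mono[of "pverts G" "{i \<in> pverts G. x i \<noteq> 0}"] by (simp add: num_active_eq_card)
qed

lemma tendsto_sum_throughput:
  "((\<lambda>\<nu>. \<Sum>i\<in>pverts G. throughput G C \<nu> i) \<longlongrightarrow> real (max_active G C) / real C) at_top"
  unfolding sum_throughput max_active_def divide_inverse[of _ "real C"]
  by (intro tendsto_mult_right tendsto_power_weighted_mean
      finite_feasible_states feasible_states_nonempty)

text \<open>\<open>Lim\<close> is a definite description, so its value comes from the convergence
  above and uniqueness of limits along the nontrivial filter \<open>at_top\<close>. At
  \<open>C = 0\<close> both sides are 0, since division by zero gives 0.\<close>

lemma aggregate_throughput_eq: "aggregate_throughput G C = real (max_active G C) / real C"
  unfolding aggregate_throughput_def
  by (rule tendsto_Lim[OF _ tendsto_sum_throughput]) simp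

section \<open>States as families of disjoint independent sets\<close>

lemma card_le_independence_number:
  assumes "independent_set G S"
  shows "card S \<le> independence_number G"
proof -
  have "finite {S. independent_set G S}"
    by (rule finite_subset[of _ "Pow (pverts G)"]) (auto simp: independent_set_def)
  with assms show ?thesis
    unfolding independence_number_def by (intro Max_ge) auto
qed

lemma disjoint_independent_family:
  assumes x: "x \<in> feasible_states G C"
  defines "f \<equiv> \<lambda>c. {i \<in> pverts G. x i = c}"
  shows "\<And>c. c \<in> {1..C} \<Longrightarrow> independent_set G (f c)"
    and "disjoint_family_on f {1..C}"
    and "(\<Sum>c\<in>{1..C}. card (f c)) = num_active G x"
proof -
  \<comment> \<open>Because \<open>c \<ge> 1\<close>, two nodes of the class have a nonzero product,
    so the constraint on an edge between them would force different channels.\<close>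
  show "independent_set G (f c)" if "c \<in> {1..C}" for c
    using x that by (fastforce simp: feasible_states_def independent_set_def f_def)
  show dis: "disjoint_family_on f {1..C}"
    by (auto simp: disjoint_family_on_def f_def)
  have "(\<Union>c\<in>{1..C}. f c) = {i \<in> pverts G. x i \<noteq> 0}"
    using x by (auto simp: feasible_states_def f_def PiE_iff Suc_le_eq)
  then show "(\<Sum>c\<in>{1..C}. card (f c)) = num_active G x"
    using dis card_UN_disjoint'[of f "{1..C}"]
    by (simp add: num_active_eq_card f_def)
qed

text \<open>Conversely, a family becomes a state by giving each class its own channel and leaving
  all other nodes inactive. The index set is arbitrary so that a set of sets, or a channel range
  with one channel removed, can serve directly.\<close>

lemma sum_card_le_max_active:
  assumes fin: "finite I" and card: "card I = C"
    and ind: "\<And>c. c \<in> I \<Longrightarrow> independent_set G (f c)"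
    and dis: "disjoint_family_on f I"
  shows "(\<Sum>c\<in>I. card (f c)) \<le> max_active G C"
proof -
  obtain h where h: "bij_betw h I {1..C}"
    using finite_same_card_bij[of I "{1..C}"] fin card by auto
  define U where "U = (\<Union>c\<in>I. f c)"
  have U: "U \<subseteq> pverts G"
    using ind by (auto simp: U_def independent_set_def)
  \<comment> \<open>Any choice \<open>k\<close> of a class for each node gives a feasible state.
    Disjointness enters below, where the class sizes must add up to \<open>card U\<close>.\<close>
  have "\<forall>i\<in>U. \<exists>c\<in>I. i \<in> f c" by (auto simp: U_def)
  then obtain k where k: "\<And>i. i \<in> U \<Longrightarrow> k i \<in> I \<and> i \<in> f (k i)" by metis
  define x where "x = restrict (\<lambda>i. if i \<in> U then h (k i) else 0) (pverts G)"
  have hk: "h (k i) \<in> {1..C}" if "i \<in> U" for i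
    using k[OF that] h by (auto simp: bij_betw_def)
  have "x \<in> feasible_states G C"
    unfolding feasible_states_def
  proof (intro CollectI conjI ballI, goal_cases)
    case 1
    then show ?case using hk by (auto simp: x_def)
  next
    case (2 e)
    obtain i j where e: "e = (i, j)" by (cases e)
    with 2 have ij: "i \<in> pverts G" "j \<in> pverts G" by (auto dest: wellformed')
    \<comment> \<open>Adjacent nodes on one nonzero channel would, by injectivity of
      \<open>h\<close>, lie in the same independent class.\<close>
    show ?case
    proof (rule ccontr)
      assume "\<not> ?case"
      then have *: "x i * x j \<noteq> 0" "x i = x j" by (auto simp: e)
      then have iU: "i \<in> U" "j \<in> U" using ij by (auto simp: x_def split: if_splits)
      with * ij have "h (k i) = h (k j)" by (auto simp: x_def)
      then have "k i = k j"
        using h k iU by (auto simp: bij_betw_def inj_on_def)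
      then have "i \<in> f (k i)" "j \<in> f (k i)" "k i \<in> I" using k iU by metis+
      then show False using ind[of "k i"] 2 e by (auto simp: independent_set_def)
    qed
  qed
  then have "num_active G x \<le> max_active G C" by (rule num_active_le_max_active)
  moreover have "{i \<in> pverts G. x i \<noteq> 0} = U"
    using U hk by (auto simp: x_def Suc_le_eq)
  moreover have "finite (f c)" if "c \<in> I" for c
    using U that by (intro finite_subset[of "f c" "pverts G"]) (auto simp: U_def)
  then have "card U = (\<Sum>c\<in>I. card (f c))"
    unfolding U_def using fin dis by (intro card_UN_disjoint')
  ultimately show ?thesis by (simp add: num_active_eq_card)
qed

section \<open>Few channels: disjoint maximum independent sets\<close>

lemma max_active_le_independence_number: "max_active G C \<le> C * independence_number G"
proof -
  obtain x where x: "x \<in> feasible_states G C" "num_active G x = max_active G C"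
    by (rule max_active_attained)
  note fam = disjoint_independent_family[OF x(1)]
  have "max_active G C = (\<Sum>c\<in>{1..C}. card {i \<in> pverts G. x i = c})"
    using fam(3) x(2) by simp
  also have "\<dots> \<le> (\<Sum>c\<in>{1..C}. independence_number G)"
    by (intro sum_mono card_le_independence_number fam(1))
  finally show ?thesis by simp
qed

lemma max_active_eq_independence_number:
  assumes C: "C \<le> max_disjoint_mis G"
  shows "max_active G C = C * independence_number G"
proof (rule antisym[OF max_active_le_independence_number])
  let ?Fs = "{F. (\<forall>S\<in>F. maximum_independent_set G S) \<and> disjoint F}"
  \<comment> \<open>The candidate families are finitely many and include the empty one, so the
    \<open>Max\<close> defining \<open>max_disjoint_mis\<close> is attained by some
    \<open>F\<close>; any \<open>C\<close> members of \<open>F\<close> then serve as channel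
    classes.\<close>
  have sub: "?Fs \<subseteq> Pow (Pow (pverts G))"
    by (auto simp: maximum_independent_set_def independent_set_def)
  then have "finite ?Fs" by (rule finite_subset) simp
  moreover have "{} \<in> ?Fs" by (simp add: disjoint_def)
  ultimately have "max_disjoint_mis G \<in> card ` ?Fs"
    unfolding max_disjoint_mis_def by (intro Max_in) blast+
  then obtain F where F: "F \<in> ?Fs" "card F = max_disjoint_mis G" by auto
  then obtain I where I: "I \<subseteq> F" "card I = C" "finite I"
    using C obtain_subset_with_card_n[of C F] by metis
  have mis: "maximum_independent_set G S" if "S \<in> I" for S
    using that I F by auto
  have "disjoint_family_on (\<lambda>S. S) I"
    using F I unfolding disjoint_family_on_def disjoint_def by blast
  then have "(\<Sum>S\<in>I. card S) \<le> max_active G C"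
    using I mis by (intro sum_card_le_max_active) (auto simp: maximum_independent_set_def)
  also have "(\<Sum>S\<in>I. card S) = C * independence_number G"
    using mis I by (simp add: maximum_independent_set_def)
  finally show "C * independence_number G \<le> max_active G C" .
qed

section \<open>Many channels: proper colorings\<close>

text \<open>The \<open>LEAST\<close> is meaningful because numbering the vertices gives a proper
  coloring: the graph has no loops.\<close>

lemma proper_coloring_chromatic_number: "\<exists>f. proper_coloring G (chromatic_number G) f"
proof -
  obtain h where h: "bij_betw h (pverts G) {1..card (pverts G)}"
    using finite_same_card_bij[of "pverts G" "{1..card (pverts G)}"] by auto
  have "proper_coloring G (card (pverts G)) h"
    unfolding proper_coloring_def
  proof (intro conjI ballI)
    show "h \<in> pverts G \<rightarrow> {1..card (pverts G)}"
      using h by (auto simp: bij_betw_def)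
    fix e assume "e \<in> parcs G"
    then show "case e of (u, v) \<Rightarrow> h u \<noteq> h v"
      using h pair_no_loops[of e] arc_fst_in_verts[of e] arc_snd_in_verts[of e]
      by (cases e) (auto simp: bij_betw_def dest: inj_onD)
  qed
  then show ?thesis
    unfolding chromatic_number_def by (intro LeastI[where P = "\<lambda>k. \<exists>f. proper_coloring G k f"] exI)
qed

text \<open>Colors start at 1, so a proper coloring never takes the inactive value 0 and, read as a
  state, activates every node.\<close>

lemma max_active_eq_card:
  assumes C: "chromatic_number G \<le> C"
  shows "max_active G C = card (pverts G)"
proof (rule antisym[OF max_active_le_card])
  obtain f where f: "proper_coloring G (chromatic_number G) f"
    using proper_coloring_chromatic_number by blast
  define x where "x = restrict f (pverts G)"
  have "x \<in> feasible_states G C"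
    unfolding feasible_states_def
  proof (intro CollectI conjI ballI)
    show "x \<in> pverts G \<rightarrow>\<^sub>E {0..C}"
      using f C unfolding x_def proper_coloring_def
      by (intro PiE_I) (auto simp: Pi_iff intro: order_trans)
    fix e assume "e \<in> parcs G"
    then show "case e of (i, j) \<Rightarrow> x i * x j = 0 \<or> x i \<noteq> x j"
      using f by (auto simp: x_def proper_coloring_def dest: wellformed')
  qed
  then have "num_active G x \<le> max_active G C" by (rule num_active_le_max_active)
  moreover have "{i \<in> pverts G. x i \<noteq> 0} = pverts G"
    using f by (auto simp: x_def proper_coloring_def Pi_iff Suc_le_eq)
  ultimately show "card (pverts G) \<le> max_active G C"
    by (simp add: num_active_eq_card)
qed

section \<open>Monotonicity in the number of channels\<close>

text \<open>Removing a smallest class \<open>f d\<close> from an optimal state on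
  \<open>Suc C\<close> channels leaves \<open>C\<close> disjoint independent sets, whose average
  size is at least \<open>card (f d)\<close>.\<close>

lemma max_active_Suc: "C * max_active G (Suc C) \<le> Suc C * max_active G C"
proof -
  let ?I = "{1..Suc C}"
  obtain x where x: "x \<in> feasible_states G (Suc C)" "num_active G x = max_active G (Suc C)"
    by (rule max_active_attained)
  define f where "f = (\<lambda>c. {i \<in> pverts G. x i = c})"
  note fam = disjoint_independent_family[OF x(1), folded fun_cong[OF f_def] f_def]
  obtain d where d: "d \<in> ?I" "\<And>c. c \<in> ?I \<Longrightarrow> card (f d) \<le> card (f c)"
    using ex_min_if_finite[of "(\<lambda>c. card (f c)) ` ?I"] by (force simp: not_less)
  have split: "max_active G (Suc C) = card (f d) + (\<Sum>c\<in>?I - {d}. card (f c))"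
    unfolding x(2)[symmetric] fam(3)[symmetric] using d(1) by (intro sum.remove) auto
  have "(\<Sum>c\<in>?I - {d}. card (f c)) \<le> max_active G C"
  proof (rule sum_card_le_max_active)
    show "disjoint_family_on f (?I - {d})"
      using fam(2) by (rule disjoint_family_on_mono[rotated]) auto
  qed (use d fam(1) in auto)
  moreover have "(\<Sum>c\<in>?I - {d}. card (f d)) \<le> (\<Sum>c\<in>?I - {d}. card (f c))"
    using d by (intro sum_mono) auto
  then have "C * card (f d) \<le> (\<Sum>c\<in>?I - {d}. card (f c))"
    using d(1) by simp
  \<comment> \<open>With \<open>R\<close> the total size of the remaining classes,
    \<open>C * card (f d) \<le> R \<le> max_active G C\<close>; add
    \<open>C * R \<le> C * max_active G C\<close>.\<close>
  ultimately have
    "C * card (f d) + C * (\<Sum>c\<in>?I - {d}. card (f c))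
      \<le> max_active G C + C * max_active G C"
    by (meson add_mono mult_le_mono2 order_trans)
  then show ?thesis
    unfolding split by (simp only: distrib_left mult_Suc)
qed

lemma antimono_on_aggregate_throughput: "antimono_on {1..} (aggregate_throughput G)"
proof (rule monotone_onI)
  fix C D :: nat
  assume C: "C \<in> {1..}" and "C \<le> D"
  from \<open>C \<le> D\<close> show "aggregate_throughput G D \<le> aggregate_throughput G C"
  proof (induction D rule: dec_induct)
    case (step D)
    \<comment> \<open>This is the claim for one step with denominators cleared;
      \<open>1 \<le> C \<le> D\<close> makes them positive.\<close>
    have "real (D * max_active G (Suc D)) \<le> real (Suc D * max_active G D)"
      using max_active_Suc by (rule of_nat_mono)
    then have "aggregate_throughput G (Suc D) \<le> aggregate_throughput G D"
      using C step.hyps unfolding aggregate_throughput_eq by (simp add: field_simps)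
    with step.IH show ?case by simp
  qed simp
qed

end

theorem theorem4p1:
  fixes G :: "'v pair_pre_digraph" and N :: nat
  assumes "pair_graph G"
    and "N = card (pverts G)" and "N \<ge> 1"
  shows "(\<forall>C\<ge>1. ((\<lambda>\<nu>. \<Sum>i\<in>pverts G. throughput G C \<nu> i) \<longlongrightarrow> aggregate_throughput G C) at_top
                \<and> aggregate_throughput G C = real (max_active G C) / real C)
       \<and> (\<forall>C. 1 \<le> C \<and> C \<le> max_disjoint_mis G \<longrightarrow>
                aggregate_throughput G C = real (independence_number G))
       \<and> (\<forall>C\<ge>chromatic_number G. aggregate_throughput G C = real N / real C)
       \<and> antimono_on {1..} (aggregate_throughput G)"
proof -
  interpret pair_graph G by fact
  show ?thesis
    using assms(2) tendsto_sum_throughput antimono_on_aggregate_throughput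
    by (auto simp: aggregate_throughput_eq max_active_eq_independence_number max_active_eq_card)
qed

end
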